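(* For integers $j\ge1$ define functions on $x>-1$ by $f_{0,j}(x)=\ln^j(1+x)$ and $f_{n,j}(x)=\int_0^x f_{n-1,j}(t)\,dt$ for $n\ge1$, and write (uniquely) $$f_{n,j}(x)=A_{n,j}(x)+\sum_{k=1}^{j}B_{n,k,j}(x)\ln^k(1+x)$$ with polynomials $A_{n,j}$, $B_{n,k,j}$. Then for all $n\ge0$, $j\ge1$, $1\le k\le j$, $$B_{n,k,j}(x)=\frac{(-1)^{j-k}\,j!}{n!\,k!}\,H_{n,j-k}\,(1+x)^n.$$
   Context: For $n\ge0$, $m\ge0$, $H_{n,m}=\sum_{1\le a_1\le a_2\le\cdots\le a_m\le n}\frac{1}{a_1a_2\cdots a_m}$, the sum over all nondecreasing $m$-tuples with entries in $\{1,\dots,n\}$; thus $H_{n,0}=1$ for all $n\ge0$, $H_{0,m}=0$ for $m\ge1$, and $H_{n,1}$ is the harmonic number $H_n$. *)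

theory Defs
  imports "HOL-Analysis.Analysis" "HOL-Computational_Algebra.Polynomial"
begin

text \<open>The tuples \<open>1 \<le> a\<^sub>1 \<le> \<dots> \<le> a\<^sub>m \<le> n\<close> are encoded as sorted lists of length \<open>m\<close>;
  the empty list contributes \<open>1\<close>, so that \<open>H n 0 = 1\<close> also for \<open>n = 0\<close>.\<close>

definition H :: "nat \<Rightarrow> nat \<Rightarrow> real" where
  "H n m = (\<Sum>as \<in> {as. length as = m \<and> sorted as \<and> set as \<subseteq> {1..n}}. 1 / real (prod_list as))"

text \<open>The functions are meant on \<open>x > -1\<close>; the values elsewhere are irrelevant.
  The interval integral is oriented, which matters for \<open>-1 < x < 0\<close>.\<close>

primrec iter_log_int :: "nat \<Rightarrow> nat \<Rightarrow> real \<Rightarrow> real" where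
  "iter_log_int 0 j = (\<lambda>x. ln (1 + x) ^ j)"
| "iter_log_int (Suc n) j = (\<lambda>x. LBINT t=ereal 0..ereal x. iter_log_int n j t)"

text \<open>\<open>B k\<close> is only relevant for \<open>1 \<le> k \<le> j\<close>.\<close>

definition log_decomposition ::
    "nat \<Rightarrow> nat \<Rightarrow> real poly \<Rightarrow> (nat \<Rightarrow> real poly) \<Rightarrow> bool" where
  "log_decomposition n j A B \<longleftrightarrow>
    (\<forall>x>-1. iter_log_int n j x = poly A x + (\<Sum>k=1..j. poly (B k) x * ln (1 + x) ^ k))"

end

theory Submission
  imports Defs "HOL-Real_Asymp.Real_Asymp"
begin

text \<open>Splitting off a last entry \<open>n + 1\<close> gives
  \<open>H (n + 1) (m + 1) = H n (m + 1) + H (n + 1) m / (n + 1)\<close>, which is exactly the relation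
  needed for \<open>\<Sum>k\<le>j. c n k * (1 + x) ^ n * ln (1 + x) ^ k\<close>, with \<open>c n k\<close> the claimed coefficient
  (also for \<open>k = 0\<close>), to be the derivative of the same expression for \<open>n + 1\<close>. Hence it differs
  from the iterated integral by a polynomial only. The decomposition is unique because the powers
  of \<open>ln u\<close> are linearly independent over the polynomials in \<open>u\<close>: letting \<open>u\<close> tend to \<open>0\<close> in a
  relation shows that all its coefficients vanish at \<open>0\<close>, so \<open>u\<close> can be cancelled,
  and this can be repeated.\<close>

section \<open>Recurrence for the sums \<open>H\<close>\<close>

lemma finite_sorted_lists:
  "finite {as :: nat list. length as = m \<and> sorted as \<and> set as \<subseteq> {1..n}}"
  by (rule finite_subset[OF _ finite_lists_length_eq[of "{1..n}" m]]) auto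

lemma H_0_right: "H n 0 = 1"
proof -
  have "{as :: nat list. length as = 0 \<and> sorted as \<and> set as \<subseteq> {1..n}} = {[]}" by auto
  then show ?thesis by (simp add: H_def)
qed

lemma H_0_Suc: "H 0 (Suc m) = 0"
proof -
  have "{as :: nat list. length as = Suc m \<and> sorted as \<and> set as \<subseteq> {1..0}} = {}" by auto
  then show ?thesis unfolding H_def by (simp only: sum.empty)
qed

lemma H_Suc_Suc: "H (Suc n) (Suc m) = H n (Suc m) + H (Suc n) m / real (Suc n)"
proof -
  define S where "S n m = {as :: nat list. length as = m \<and> sorted as \<and> set as \<subseteq> {1..n}}" for n m
  define g where "g = (\<lambda>as :: nat list. as @ [Suc n])"
  have fin: "finite (S n m)" for n m unfolding S_def by (rule finite_sorted_lists)
  have H: "H n m = (\<Sum>as\<in>S n m. 1 / real (prod_list as))" for n m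
    by (simp add: H_def S_def)
  \<comment> \<open>The last entry of a sorted list is its largest: either it is
    \<open>Suc n\<close> and can be removed, or all entries are at most \<open>n\<close>.\<close>
  have split: "S (Suc n) (Suc m) = S n (Suc m) \<union> g ` S (Suc n) m"
  proof (intro equalityI subsetI)
    fix as assume as: "as \<in> S (Suc n) (Suc m)"
    then obtain bs b where bs: "as = bs @ [b]" by (cases as rule: rev_cases) (auto simp: S_def)
    show "as \<in> S n (Suc m) \<union> g ` S (Suc n) m"
    proof (cases "b = Suc n")
      case True
      then show ?thesis using as bs by (auto simp: S_def g_def sorted_append)
    next
      case False
      then have "as \<in> S n (Suc m)"
        using as bs by (fastforce simp: S_def sorted_append)
      then show ?thesis ..
    qed
  next
    fix as assume "as \<in> S n (Suc m) \<union> g ` S (Suc n) m"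
    then show "as \<in> S (Suc n) (Suc m)"
      by (fastforce simp: S_def g_def sorted_append)
  qed
  have disj: "S n (Suc m) \<inter> g ` S (Suc n) m = {}" by (auto simp: S_def g_def)
  have inj: "inj_on g A" for A by (auto simp: inj_on_def g_def)
  have "H (Suc n) (Suc m) = H n (Suc m) + (\<Sum>as\<in>g ` S (Suc n) m. 1 / real (prod_list as))"
    unfolding H split by (rule sum.union_disjoint) (auto simp: fin disj)
  also have "(\<Sum>as\<in>g ` S (Suc n) m. 1 / real (prod_list as)) = H (Suc n) m / real (Suc n)"
    unfolding H sum.reindex[OF inj] sum_divide_distrib
    by (intro sum.cong) (simp_all add: g_def algebra_simps)
  finally show ?thesis .
qed

section \<open>Antiderivatives of the polynomial and the logarithmic parts\<close>

lemma ex_pderiv_eq: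
  fixes p :: "real poly"
  obtains q where "pderiv q = p" "poly q 0 = c"
proof
  let ?q = "pCons c (\<Sum>i\<le>degree p. monom (coeff p i / real (Suc i)) i)"
  show "pderiv ?q = p"
    by (intro poly_eqI)
      (auto simp: coeff_pderiv coeff_sum coeff_monom coeff_eq_0 simp del: of_nat_Suc)
  show "poly ?q 0 = c" by simp
qed

definition log_coeff :: "nat \<Rightarrow> nat \<Rightarrow> nat \<Rightarrow> real" where
  "log_coeff n j k = (-1) ^ (j - k) * fact j / (fact n * fact k) * H n (j - k)"

text \<open>Keeping \<open>k = 0\<close>, although that term is itself a polynomial, lets
  differentiation lower \<open>n\<close> exactly, with no correction term.\<close>

definition log_primitive :: "nat \<Rightarrow> nat \<Rightarrow> real \<Rightarrow> real" where
  "log_primitive n j x = (\<Sum>k\<le>j. log_coeff n j k * (1 + x) ^ n * ln (1 + x) ^ k)"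

lemma log_coeff_top: "log_coeff n j j = 1 / fact n"
  by (simp add: log_coeff_def H_0_right)

text \<open>Compares coefficients of \<open>(1 + x) ^ n * ln (1 + x) ^ k\<close> after
  differentiation: lowering the power of \<open>1 + x\<close> yields \<open>Suc n\<close>, lowering
  that of the logarithm yields \<open>Suc k\<close>. The two terms have opposite signs, so the
  recurrence for \<open>H\<close> leaves only \<open>H n (j - k)\<close>.\<close>

lemma log_coeff_Suc:
  assumes "k < j"
  shows "real (Suc n) * log_coeff (Suc n) j k + real (Suc k) * log_coeff (Suc n) j (Suc k)
    = log_coeff n j k"
proof -
  obtain d where d: "j = Suc (k + d)" using assms less_iff_Suc_add by blast
  have e: "j - k = Suc d" "j - Suc k = d" using d by auto
  show ?thesis
    unfolding log_coeff_def e H_Suc_Suc[of n d]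
    by (simp add: divide_simps del: of_nat_Suc) (simp add: algebra_simps)
qed

lemma log_primitive_0: "log_primitive 0 j x = ln (1 + x) ^ j"
proof -
  \<comment> \<open>At \<open>n = 0\<close> the sums \<open>H 0 (j - k)\<close> with
    \<open>k < j\<close> are empty; only the top power survives.\<close>
  have "log_coeff 0 j k = (if k = j then 1 else 0)" if "k \<le> j" for k
  proof (cases "k = j")
    case False
    with that obtain d where "j - k = Suc d" by (metis Suc_diff_Suc le_neq_implies_less)
    with False show ?thesis by (simp add: log_coeff_def H_0_Suc)
  qed (simp add: log_coeff_top)
  then have "log_primitive 0 j x = (\<Sum>k\<le>j. if k = j then ln (1 + x) ^ k else 0)"
    unfolding log_primitive_def by (intro sum.cong) auto
  then show ?thesis by simp
qed

lemma DERIV_log_primitive: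
  assumes "x > -1"
  shows "(log_primitive (Suc n) j has_real_derivative log_primitive n j x) (at x)"
proof -
  let ?c = "log_coeff (Suc n) j" and ?L = "ln (1 + x)"
  have "(log_primitive (Suc n) j has_real_derivative
      (\<Sum>k\<le>j. real (Suc n) * ?c k * (1 + x) ^ n * ?L ^ k
        + real k * ?c k * (1 + x) ^ n * ?L ^ (k - 1))) (at x)"
    unfolding log_primitive_def[abs_def]
  proof (rule DERIV_sum)
    fix k
    show "((\<lambda>x. ?c k * (1 + x) ^ Suc n * ln (1 + x) ^ k) has_real_derivative
        real (Suc n) * ?c k * (1 + x) ^ n * ?L ^ k + real k * ?c k * (1 + x) ^ n * ?L ^ (k - 1)) (at x)"
    proof (rule DERIV_cong)
      have "((\<lambda>x. ln (1 + x)) has_real_derivative 1 / (1 + x)) (at x)"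
        using assms by (auto intro!: derivative_eq_intros)
      note L = DERIV_power[OF this, of k]
      have "((\<lambda>x. 1 + x) has_real_derivative 1) (at x)"
        by (auto intro!: derivative_eq_intros)
      note U = DERIV_cmult[OF DERIV_power[OF this, of "Suc n"], of "?c k"]
      show "((\<lambda>x. ?c k * (1 + x) ^ Suc n * ln (1 + x) ^ k) has_real_derivative
          ?c k * (real (Suc n) * (1 * (1 + x) ^ (Suc n - Suc 0))) * ?L ^ k
          + real k * (1 / (1 + x) * ?L ^ (k - Suc 0)) * (?c k * (1 + x) ^ Suc n)) (at x)"
        by (rule DERIV_mult[OF U L])
      \<comment> \<open>The factor \<open>1 / (1 + x)\<close> from the logarithm cancels one of the
        \<open>Suc n\<close> factors \<open>1 + x\<close>, nonzero here.\<close>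
      show "?c k * (real (Suc n) * (1 * (1 + x) ^ (Suc n - Suc 0))) * ?L ^ k
          + real k * (1 / (1 + x) * ?L ^ (k - Suc 0)) * (?c k * (1 + x) ^ Suc n)
        = real (Suc n) * ?c k * (1 + x) ^ n * ?L ^ k + real k * ?c k * (1 + x) ^ n * ?L ^ (k - 1)"
        using assms by (simp del: of_nat_Suc)
    qed
  qed
  moreover have "(\<Sum>k\<le>j. real (Suc n) * ?c k * (1 + x) ^ n * ?L ^ k
        + real k * ?c k * (1 + x) ^ n * ?L ^ (k - 1)) = log_primitive n j x"
  proof -
    \<comment> \<open>The term \<open>k = 0\<close> carries the factor \<open>0\<close>, so the
      truncated exponent \<open>k - 1\<close> is harmless there and the index can be
      shifted.\<close>
    have "(\<Sum>k\<le>j. real k * ?c k * (1 + x) ^ n * ?L ^ (k - 1))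
        = (\<Sum>k<j. real (Suc k) * ?c (Suc k) * (1 + x) ^ n * ?L ^ k)"
      by (simp add: sum.atMost_shift)
    moreover have "(\<Sum>k\<le>j. real (Suc n) * ?c k * (1 + x) ^ n * ?L ^ k)
        = (\<Sum>k<j. real (Suc n) * ?c k * (1 + x) ^ n * ?L ^ k)
          + real (Suc n) * ?c j * (1 + x) ^ n * ?L ^ j"
      by (simp add: lessThan_Suc_atMost[symmetric])
    moreover have "log_primitive n j x
        = (\<Sum>k<j. log_coeff n j k * (1 + x) ^ n * ?L ^ k) + log_coeff n j j * (1 + x) ^ n * ?L ^ j"
      by (simp add: log_primitive_def lessThan_Suc_atMost[symmetric])
    moreover have "(\<Sum>k<j. log_coeff n j k * (1 + x) ^ n * ?L ^ k)
        = (\<Sum>k<j. real (Suc n) * ?c k * (1 + x) ^ n * ?L ^ k)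
          + (\<Sum>k<j. real (Suc k) * ?c (Suc k) * (1 + x) ^ n * ?L ^ k)"
      unfolding sum.distrib[symmetric]
    proof (rule sum.cong[OF refl])
      fix k assume "k \<in> {..<j}"
      then have "real (Suc n) * ?c k + real (Suc k) * ?c (Suc k) = log_coeff n j k"
        by (intro log_coeff_Suc) simp
      then show "log_coeff n j k * (1 + x) ^ n * ?L ^ k
          = real (Suc n) * ?c k * (1 + x) ^ n * ?L ^ k
            + real (Suc k) * ?c (Suc k) * (1 + x) ^ n * ?L ^ k"
        by (metis distrib_right)
    qed
    \<comment> \<open>The top power receives nothing from a higher one, so its coefficient is
      compared separately.\<close>
    moreover have "real (Suc n) * ?c j = log_coeff n j j"
      by (simp add: log_coeff_top del: of_nat_Suc)
    ultimately show ?thesis by (simp only: sum.distrib)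
  qed
  ultimately show ?thesis by simp
qed

section \<open>Closed form of the iterated integrals\<close>

lemma iter_log_int_eq:
  obtains P where "\<And>x. x > -1 \<Longrightarrow> iter_log_int n j x = poly P x + log_primitive n j x"
proof -
  have "\<exists>P. \<forall>x>-1. iter_log_int n j x = poly P x + log_primitive n j x"
  proof (induction n)
    case 0
    show ?case by (rule exI[of _ 0]) (simp add: log_primitive_0)
  next
    case (Suc n)
    then obtain P where P: "\<And>x. x > -1 \<Longrightarrow> iter_log_int n j x = poly P x + log_primitive n j x"
      by blast
    \<comment> \<open>This constant term makes the antiderivative \<open>F\<close> vanish at the
      lower limit \<open>0\<close>.\<close>
    obtain Q where Q: "pderiv Q = P" "poly Q 0 = - log_primitive (Suc n) j 0"
      by (rule ex_pderiv_eq)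
    define F where "F = (\<lambda>x. poly Q x + log_primitive (Suc n) j x)"
    have DF: "(F has_real_derivative iter_log_int n j x) (at x)" if "x > -1" for x
      unfolding F_def P[OF that] Q(1)[symmetric]
      by (intro DERIV_add poly_DERIV DERIV_log_primitive that)
    have cont: "continuous_on {-1<..} (iter_log_int n j)"
    proof -
      have "continuous_on {-1<..} (\<lambda>x. poly P x + log_primitive n j x)"
        unfolding log_primitive_def by (intro continuous_intros) auto
      then show ?thesis by (rule continuous_on_eq) (auto simp: P)
    qed
    have "iter_log_int (Suc n) j x = F x" if "x > -1" for x
    proof -
      \<comment> \<open>The fundamental theorem is used on the segment between \<open>0\<close> and
        \<open>x\<close> in either order; it stays to the right of \<open>-1\<close>.\<close>
      have "(LBINT t=ereal 0..ereal x. iter_log_int n j t) = F x - F 0"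
      proof (rule interval_integral_FTC_finite)
        show "continuous_on {min 0 x..max 0 x} (iter_log_int n j)"
          by (rule continuous_on_subset[OF cont]) (use that in auto)
        fix y assume "min 0 x \<le> y" "y \<le> max 0 x"
        then have "y > -1" using that by linarith
        then show "(F has_vector_derivative iter_log_int n j y) (at y within {min 0 x..max 0 x})"
          using DF has_field_derivative_at_within has_real_derivative_iff_has_vector_derivative
          by blast
      qed
      moreover have "F 0 = 0" by (simp add: F_def Q)
      ultimately show ?thesis by simp
    qed
    then show ?case unfolding F_def by blast
  qed
  then show ?thesis using that by blast
qed

section \<open>Independence of the powers of \<open>ln\<close> over the polynomials\<close>

lemma poly_tendsto_0_at_bot:
  fixes p :: "real poly"
  assumes "(poly p \<longlongrightarrow> 0) at_bot"
  shows "p = 0"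
proof (cases "degree p = 0")
  case True
  then obtain c where "p = [:c:]" by (rule degree_eq_zeroE)
  moreover from this have "poly p = (\<lambda>_. c)" by auto
  ultimately show ?thesis using assms by (simp add: tendsto_const_iff)
next
  case False
  then have "filterlim (poly p) at_infinity at_bot"
    by (intro filterlim_mono[OF filterlim_poly_at_infinity order.refl at_bot_le_at_infinity]) simp
  with assms show ?thesis
    using not_tendsto_and_filterlim_at_infinity[of at_bot "poly p" 0] by simp
qed

lemma poly_ln_independent:
  fixes q :: "nat \<Rightarrow> real poly"
  assumes "\<And>u. u > 0 \<Longrightarrow> (\<Sum>k\<le>m. poly (q k) u * ln u ^ k) = 0" "k \<le> m"
  shows "q k = 0"
proof -
  \<comment> \<open>Induction on an index \<open>D\<close> from which on all coefficients vanish: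
    cancelling \<open>u\<close> lowers it by one, and \<open>D = 0\<close> forces every
    \<open>q k\<close> to be zero.\<close>
  have "\<forall>k\<le>m. q k = 0"
    if "\<forall>k\<le>m. \<forall>i\<ge>D. coeff (q k) i = 0"
      and "\<forall>u>0. (\<Sum>k\<le>m. poly (q k) u * ln u ^ k) = 0" for D and q :: "nat \<Rightarrow> real poly"
    using that
  proof (induction D arbitrary: q)
    case 0
    then show ?case by (auto intro: poly_eqI)
  next
    case (Suc D)
    define r where "r k = poly_shift 1 (q k)" for k
    have q: "q k = pCons (coeff (q k) 0) (r k)" for k
      by (rule poly_eqI) (auto simp: r_def coeff_poly_shift coeff_pCons split: nat.split)
    \<comment> \<open>\<open>R\<close> gathers the constant terms of the \<open>q k\<close> as a
      polynomial in \<open>ln u\<close>; the rest has a factor \<open>u\<close>.\<close>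
    define R where "R = (\<Sum>k\<le>m. monom (coeff (q k) 0) k)"
    have R: "poly R (ln u) = - (\<Sum>k\<le>m. poly (r k) u * (u * ln u ^ k))" if "u > 0" for u
    proof -
      have "0 = (\<Sum>k\<le>m. poly (q k) u * ln u ^ k)" using Suc.prems that by simp
      also have "\<dots> = (\<Sum>k\<le>m. coeff (q k) 0 * ln u ^ k) + (\<Sum>k\<le>m. poly (r k) u * (u * ln u ^ k))"
        by (subst q) (simp add: algebra_simps sum.distrib)
      finally show ?thesis by (simp add: R_def poly_sum poly_monom)
    qed
    \<comment> \<open>The factor \<open>u\<close> beats every power of the logarithm at
      \<open>0\<close>, so the remainder tends to \<open>0\<close>.\<close>
    have lim: "((\<lambda>u :: real. u * ln u ^ k) \<longlongrightarrow> 0) (at_right 0)" for k by real_asymp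
    have "((\<lambda>u. - (\<Sum>k\<le>m. poly (r k) u * (u * ln u ^ k))) \<longlongrightarrow> - (\<Sum>k\<le>m. poly (r k) 0 * 0)) (at_right 0)"
      by (intro tendsto_minus tendsto_sum tendsto_mult lim tendsto_intros)
    then have "((\<lambda>u. poly R (ln u)) \<longlongrightarrow> 0) (at_right 0)"
      by (auto elim!: Lim_transform_eventually intro!: eventually_at_rightI[of 0 1] simp: R)
    \<comment> \<open>With \<open>u = exp y\<close>, the argument of \<open>R\<close> runs to minus
      infinity, where only the zero polynomial tends to \<open>0\<close>.\<close>
    then have "((\<lambda>y. poly R (ln (exp y))) \<longlongrightarrow> 0) at_bot"
      by (rule filterlim_compose) real_asymp
    then have "R = 0" by (intro poly_tendsto_0_at_bot) simp
    have c0: "coeff (q k) 0 = 0" if "k \<le> m" for k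
      using arg_cong[OF \<open>R = 0\<close>, of "\<lambda>p. coeff p k"] that by (simp add: R_def coeff_sum coeff_monom)
    have "\<forall>k\<le>m. r k = 0"
    proof (rule Suc.IH)
      show "\<forall>k\<le>m. \<forall>i\<ge>D. coeff (r k) i = 0"
        using Suc.prems by (auto simp: r_def coeff_poly_shift)
      have "(\<Sum>k\<le>m. poly (r k) u * (u * ln u ^ k)) = u * (\<Sum>k\<le>m. poly (r k) u * ln u ^ k)" for u
        by (simp add: sum_distrib_left algebra_simps)
      then show "\<forall>u>0. (\<Sum>k\<le>m. poly (r k) u * ln u ^ k) = 0"
        using R \<open>R = 0\<close> by simp
    qed
    then show ?case using q c0 by (metis pCons_0_0)
  qed
  moreover obtain D where "\<forall>k\<le>m. \<forall>i\<ge>D. coeff (q k) i = 0"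
  proof
    show "\<forall>k\<le>m. \<forall>i\<ge>Suc (Max (degree ` q ` {..m})). coeff (q k) i = 0"
      by (auto intro!: coeff_eq_0 simp: Suc_le_eq)
  qed
  ultimately show ?thesis using assms by blast
qed

section \<open>Uniqueness and existence of the decomposition\<close>

lemma log_decomposition_unique:
  assumes "log_decomposition n j A B" "log_decomposition n j A' B'"
  shows "A = A'" "k \<in> {1..j} \<Longrightarrow> B k = B' k"
proof -
  \<comment> \<open>Slot \<open>0\<close>, the coefficient of \<open>ln (1 + x) ^ 0\<close>, holds
    the difference of the polynomial parts.\<close>
  define p where "p k = (if k = 0 then A - A' else B k - B' k)" for k
  \<comment> \<open>Change of variable \<open>u = 1 + x\<close>; composing with a nonconstant
    polynomial loses nothing, so \<open>q k = 0\<close> gives back \<open>p k = 0\<close>.\<close>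
  define q where "q k = p k \<circ>\<^sub>p [:-1, 1:]" for k
  have q: "q k = 0" if "k \<le> j" for k
  proof (rule poly_ln_independent[OF _ that])
    fix u :: real assume "u > 0"
    then have *: "u - 1 > -1" by simp
    have "(\<Sum>k\<le>j. poly (q k) u * ln u ^ k) = (\<Sum>k\<le>j. poly (p k) (u - 1) * ln u ^ k)"
      by (simp add: q_def poly_pcompose)
    also have "\<dots> = poly (A - A') (u - 1) + (\<Sum>k=1..j. poly (B k - B' k) (u - 1) * ln u ^ k)"
      by (simp add: atMost_atLeast0 sum.atLeast_Suc_atMost p_def)
    also have "\<dots> = 0"
      using assms[unfolded log_decomposition_def, rule_format, OF *]
      by (simp add: algebra_simps sum_subtractf)
    finally show "(\<Sum>k\<le>j. poly (q k) u * ln u ^ k) = 0" .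
  qed
  have p: "p k = 0" if "k \<le> j" for k
    using q[OF that] by (simp add: q_def pcompose_eq_0_iff)
  show "A = A'" using p[of 0] by (simp add: p_def)
  show "B k = B' k" if "k \<in> {1..j}" using p[of k] that by (simp add: p_def)
qed

lemma log_decomposition_exists:
  obtains A where
    "log_decomposition n j A (\<lambda>k. smult (log_coeff n j k) ([:1, 1:] ^ n))"
proof -
  obtain P where P: "\<And>x. x > -1 \<Longrightarrow> iter_log_int n j x = poly P x + log_primitive n j x"
    using iter_log_int_eq by blast
  show ?thesis
  proof
    \<comment> \<open>The sum in a decomposition starts at \<open>1\<close>, so the term
      \<open>k = 0\<close> of \<open>log_primitive\<close> joins the polynomial part.\<close>
    show "log_decomposition n j (P + smult (log_coeff n j 0) ([:1, 1:] ^ n))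
      (\<lambda>k. smult (log_coeff n j k) ([:1, 1:] ^ n))"
      by (simp add: log_decomposition_def P log_primitive_def atMost_atLeast0
          sum.atLeast_Suc_atMost)
  qed
qed

theorem theorem5p2:
  fixes n j :: nat
  assumes "j \<ge> 1"
  shows "(\<exists>A B. log_decomposition n j A B) \<and>
    (\<forall>A B A' B'. log_decomposition n j A B \<longrightarrow> log_decomposition n j A' B' \<longrightarrow>
       A = A' \<and> (\<forall>k\<in>{1..j}. B k = B' k)) \<and>
    (\<forall>A B. log_decomposition n j A B \<longrightarrow>
       (\<forall>k\<in>{1..j}. \<forall>x. poly (B k) x =
          (-1) ^ (j - k) * fact j / (fact n * fact k) * H n (j - k) * (1 + x) ^ n))"
proof -
  obtain A\<^sub>0 where A\<^sub>0: "log_decomposition n j A\<^sub>0 (\<lambda>k. smult (log_coeff n j k) ([:1, 1:] ^ n))"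
    by (rule log_decomposition_exists)
  have "poly (B k) x = (-1) ^ (j - k) * fact j / (fact n * fact k) * H n (j - k) * (1 + x) ^ n"
    if "log_decomposition n j A B" "k \<in> {1..j}" for A B k x
    using log_decomposition_unique(2)[OF that(1) A\<^sub>0 that(2)] by (simp add: log_coeff_def)
  then show ?thesis using A\<^sub>0 log_decomposition_unique by blast
qed

end
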